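(* Suppose the natural variables satisfy the structural model $W=f_W(U_W)$, $Z=f_Z(W,U_Z)$, $A=f_A(Z,W,U_A)$, $Y=f_Y(A,W,U_Y)$ with $Z\perp (U_A,U_Y)\mid W$. Let $h^*(\cdot\mid W)$ be a stochastic intervention on the instrument, and suppose the intervened variables satisfy $W=f_W(U_W)$, $Z^{h^*}=f_Z^*(W,U_Z)$, $A^{h^*}=f_A(Z^{h^*},W,U_A)$ and that $Y^{h^*}$ is generated by the structural equation $f_Y$ of the response in this intervened model, with the natural noise $U_Y$, where $Z^{h^*}\mid W$ has conditional density $h^*(\cdot\mid W)$ and $Z^{h^*}\perp (U_A,U_Y)\mid W$. Then the counterfactual outcome under the intervention on $Z$ satisfies $$Y^{h^*}=f_Y\big(A^{h^*},W,U_Y\big),$$ so that $Y^{h^*}$ depends on $Z^{h^*}$ only through $A^{h^*}$. Consequently $E[Y^{h^*}]$ is a functional of $P$ and $h^*$ whose induced conditional marginal on $A$ given $W$ is $g(h^* )(A\mid W):=p(A^{h^*}\mid W)$. In particular, writing $E[Y^{g(h^* )}]$ for the expectation of the outcome in this propagated world (in which $A=A^{h^*}$ has conditional marginal $g(h^* )$ given $W$ and the errors $U_A,U_Y$ are the natural ones), one has $E[Y^{h^*}]=E[Y^{g(h^* )}]$.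
   Context: $W$ are baseline covariates, $Z$ an instrument, $A$ a treatment, $Y$ a response; $f_W,f_Z,f_A,f_Y,f_Z^*$ are arbitrary (measurable) functions and $U_W,U_Z,U_A,U_Y$ are error terms with an arbitrary joint distribution, with no conditional independence restrictions except those stated (in particular $U_A$ and $U_Y$ may be dependent given $W$). The variable $Z$ does not enter $f_Y$ (exclusion restriction). $P$ denotes the joint law of the natural variables $(W,Z,A,Y)$. The intervened model uses the same functions $f_W,f_A,f_Y$ and the same error terms as the natural model; only the equation for $Z$ is replaced. $p(A^{h^*}\mid W)$ is the conditional density of $A^{h^*}$ given $W$. The notation $E[Y^{g(h^* )}]$ is a relabelling of the mean outcome in the propagated world and is not the mean outcome when treatment is drawn from $g(h^* )(\cdot\mid W)$ independently of $U_Y$.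
   Formalization: That E[Y^{h*}] and the marginal g(h* ) are functionals of P and h* is proved only if the law of (W,Z^{h*}) is absolutely continuous with respect to that of (W,Z); without this the claim fails (Z=0, Z^{h*}=1, Y=A, with f_A=z versus f_A=0). *)

theory Defs
  imports "HOL-Probability.Probability"
begin

text \<open>
  A structural instrumental-variable model. The errors are random variables on one probability
  space, so their joint distribution is arbitrary. The response equation has no
  instrument argument: this is the exclusion restriction.
\<close>

record ('o, 'uw, 'uz, 'ua, 'uy, 'w, 'z, 'a) iv_scm =
  Pr :: "'o measure"
  SUW :: "'uw measure"
  SUZ :: "'uz measure"
  SUA :: "'ua measure"
  SUY :: "'uy measure"
  UW :: "'o \<Rightarrow> 'uw"
  UZ :: "'o \<Rightarrow> 'uz"
  UA :: "'o \<Rightarrow> 'ua"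
  UY :: "'o \<Rightarrow> 'uy"
  fW :: "'uw \<Rightarrow> 'w"
  fZ :: "'w \<Rightarrow> 'uz \<Rightarrow> 'z"
  fA :: "'z \<Rightarrow> 'w \<Rightarrow> 'ua \<Rightarrow> 'a"
  fY :: "'a \<Rightarrow> 'w \<Rightarrow> 'uy \<Rightarrow> real"

definition iv_scm :: "'w measure \<Rightarrow> 'z measure \<Rightarrow> 'a measure \<Rightarrow>
    ('o, 'uw, 'uz, 'ua, 'uy, 'w, 'z, 'a) iv_scm \<Rightarrow> bool" where
  "iv_scm SW NZ NA S \<longleftrightarrow>
     prob_space (Pr S) \<and>
     UW S \<in> Pr S \<rightarrow>\<^sub>M SUW S \<and> UZ S \<in> Pr S \<rightarrow>\<^sub>M SUZ S \<and>
     UA S \<in> Pr S \<rightarrow>\<^sub>M SUA S \<and> UY S \<in> Pr S \<rightarrow>\<^sub>M SUY S \<and>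
     fW S \<in> SUW S \<rightarrow>\<^sub>M SW \<and>
     (\<lambda>(w, u). fZ S w u) \<in> SW \<Otimes>\<^sub>M SUZ S \<rightarrow>\<^sub>M NZ \<and>
     (\<lambda>(z, w, u). fA S z w u) \<in> NZ \<Otimes>\<^sub>M SW \<Otimes>\<^sub>M SUA S \<rightarrow>\<^sub>M NA \<and>
     (\<lambda>(a, w, u). fY S a w u) \<in> NA \<Otimes>\<^sub>M SW \<Otimes>\<^sub>M SUY S \<rightarrow>\<^sub>M borel"

text \<open>The variables generated by the structural equations.\<close>

definition var_W :: "('o, 'uw, 'uz, 'ua, 'uy, 'w, 'z, 'a) iv_scm \<Rightarrow> 'o \<Rightarrow> 'w" where
  "var_W S \<omega> = fW S (UW S \<omega>)"

definition var_Z :: "('o, 'uw, 'uz, 'ua, 'uy, 'w, 'z, 'a) iv_scm \<Rightarrow> 'o \<Rightarrow> 'z" where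
  "var_Z S \<omega> = fZ S (var_W S \<omega>) (UZ S \<omega>)"

definition var_A :: "('o, 'uw, 'uz, 'ua, 'uy, 'w, 'z, 'a) iv_scm \<Rightarrow> 'o \<Rightarrow> 'a" where
  "var_A S \<omega> = fA S (var_Z S \<omega>) (var_W S \<omega>) (UA S \<omega>)"

definition var_Y :: "('o, 'uw, 'uz, 'ua, 'uy, 'w, 'z, 'a) iv_scm \<Rightarrow> 'o \<Rightarrow> real" where
  "var_Y S \<omega> = fY S (var_A S \<omega>) (var_W S \<omega>) (UY S \<omega>)"

text \<open>The joint law \<open>P\<close> of \<open>(W, Z, A, Y)\<close>.\<close>

definition observed_law :: "'w measure \<Rightarrow> 'z measure \<Rightarrow> 'a measure \<Rightarrow>
    ('o, 'uw, 'uz, 'ua, 'uy, 'w, 'z, 'a) iv_scm \<Rightarrow> ('w \<times> 'z \<times> 'a \<times> real) measure" where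
  "observed_law SW NZ NA S =
     distr (Pr S) (SW \<Otimes>\<^sub>M NZ \<Otimes>\<^sub>M NA \<Otimes>\<^sub>M borel) (\<lambda>\<omega>. (var_W S \<omega>, var_Z S \<omega>, var_A S \<omega>, var_Y S \<omega>))"

definition intervene :: "('o, 'uw, 'uz, 'ua, 'uy, 'w, 'z, 'a) iv_scm \<Rightarrow> ('w \<Rightarrow> 'uz \<Rightarrow> 'z) \<Rightarrow>
    ('o, 'uw, 'uz, 'ua, 'uy, 'w, 'z, 'a) iv_scm" where
  "intervene S f = S\<lparr>fZ := f\<rparr>"

text \<open>\<open>cond_event M SW W E\<close> is a version of the conditional probability of the event \<open>E\<close> given \<open>W\<close>.\<close>

definition cond_event :: "'o measure \<Rightarrow> 'w measure \<Rightarrow> ('o \<Rightarrow> 'w) \<Rightarrow> 'o set \<Rightarrow> 'o \<Rightarrow> real" where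
  "cond_event M SW W E = real_cond_exp M (vimage_algebra (space M) W SW) (indicator E)"

definition cond_indep_given :: "'o measure \<Rightarrow> 'w measure \<Rightarrow> ('o \<Rightarrow> 'w) \<Rightarrow>
    'x measure \<Rightarrow> ('o \<Rightarrow> 'x) \<Rightarrow> 'v measure \<Rightarrow> ('o \<Rightarrow> 'v) \<Rightarrow> bool" where
  "cond_indep_given M SW W SX X SV V \<longleftrightarrow>
     (\<forall>B \<in> sets SX. \<forall>C \<in> sets SV. AE \<omega> in M.
        cond_event M SW W ((X -` B \<inter> space M) \<inter> (V -` C \<inter> space M)) \<omega> =
        cond_event M SW W (X -` B \<inter> space M) \<omega> * cond_event M SW W (V -` C \<inter> space M) \<omega>)"

text \<open>
  \<open>density_kernel SW N q\<close>: for each \<open>w\<close>, \<open>q w\<close> is a probability density with respect to the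
  dominating measure \<open>N\<close>.
\<close>

definition density_kernel :: "'w measure \<Rightarrow> 'x measure \<Rightarrow> ('w \<Rightarrow> 'x \<Rightarrow> real) \<Rightarrow> bool" where
  "density_kernel SW N q \<longleftrightarrow>
     (\<lambda>(w, x). q w x) \<in> borel_measurable (SW \<Otimes>\<^sub>M N) \<and>
     (\<forall>w \<in> space SW. \<forall>x \<in> space N. 0 \<le> q w x) \<and>
     (\<forall>w \<in> space SW. (\<integral>\<^sup>+ x. ennreal (q w x) \<partial>N) = 1)"

definition cond_density :: "'o measure \<Rightarrow> 'w measure \<Rightarrow> ('o \<Rightarrow> 'w) \<Rightarrow>
    'x measure \<Rightarrow> ('o \<Rightarrow> 'x) \<Rightarrow> ('w \<Rightarrow> 'x \<Rightarrow> real) \<Rightarrow> bool" where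
  "cond_density M SW W N X q \<longleftrightarrow>
     density_kernel SW N q \<and>
     (\<forall>B \<in> sets N. AE \<omega> in M.
        cond_event M SW W (X -` B \<inter> space M) \<omega> = (LINT x:B|N. q (W \<omega>) x))"

text \<open>
  Replacing the instrument equation of \<open>S\<close> by \<open>f\<close> realises the stochastic intervention with
  conditional density \<open>h\<close>, and the resulting treatment has conditional density \<open>g\<close> given \<open>W\<close>.
  The measures \<open>NZ\<close> and \<open>NA\<close> are the dominating measures of the two densities.
\<close>

definition iv_intervention :: "'w measure \<Rightarrow> 'z measure \<Rightarrow> 'a measure \<Rightarrow>
    ('o, 'uw, 'uz, 'ua, 'uy, 'w, 'z, 'a) iv_scm \<Rightarrow> ('w \<Rightarrow> 'uz \<Rightarrow> 'z) \<Rightarrow>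
    ('w \<Rightarrow> 'z \<Rightarrow> real) \<Rightarrow> ('w \<Rightarrow> 'a \<Rightarrow> real) \<Rightarrow> bool" where
  "iv_intervention SW NZ NA S f h g \<longleftrightarrow>
     sigma_finite_measure NZ \<and> sigma_finite_measure NA \<and>
     iv_scm SW NZ NA S \<and> iv_scm SW NZ NA (intervene S f) \<and>
     cond_indep_given (Pr S) SW (var_W S) NZ (var_Z S)
       (SUA S \<Otimes>\<^sub>M SUY S) (\<lambda>\<omega>. (UA S \<omega>, UY S \<omega>)) \<and>
     cond_indep_given (Pr S) SW (var_W S) NZ (var_Z (intervene S f))
       (SUA S \<Otimes>\<^sub>M SUY S) (\<lambda>\<omega>. (UA S \<omega>, UY S \<omega>)) \<and>
     cond_density (Pr S) SW (var_W S) NZ (var_Z (intervene S f)) h \<and>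
     cond_density (Pr S) SW (var_W S) NA (var_A (intervene S f)) g"

text \<open>
  Positivity: the intervention puts no mass on instrument values outside the support of
  \<open>Z\<close> given \<open>W\<close>, i.e. the law of \<open>(W, Z\<^sup>h)\<close> is absolutely continuous with respect to that of \<open>(W, Z)\<close>.
\<close>

definition instrument_positivity :: "'w measure \<Rightarrow> 'z measure \<Rightarrow>
    ('o, 'uw, 'uz, 'ua, 'uy, 'w, 'z, 'a) iv_scm \<Rightarrow> ('w \<Rightarrow> 'uz \<Rightarrow> 'z) \<Rightarrow> bool" where
  "instrument_positivity SW NZ S f \<longleftrightarrow>
     absolutely_continuous
       (distr (Pr S) (SW \<Otimes>\<^sub>M NZ) (\<lambda>\<omega>. (var_W S \<omega>, var_Z S \<omega>)))
       (distr (Pr S) (SW \<Otimes>\<^sub>M NZ) (\<lambda>\<omega>. (var_W S \<omega>, var_Z (intervene S f) \<omega>)))"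

text \<open>
  \<open>Y'\<close> is the outcome in the world in which the treatment is the propagated one, with conditional
  marginal \<open>g\<close> given \<open>W\<close>, and the errors are the natural ones. The treatment is not
  redrawn from \<open>g\<close> independently of the response error.
\<close>

definition propagated_world :: "'w measure \<Rightarrow> 'a measure \<Rightarrow>
    ('o, 'uw, 'uz, 'ua, 'uy, 'w, 'z, 'a) iv_scm \<Rightarrow> ('w \<Rightarrow> 'uz \<Rightarrow> 'z) \<Rightarrow>
    ('w \<Rightarrow> 'a \<Rightarrow> real) \<Rightarrow> ('o \<Rightarrow> 'a) \<Rightarrow> ('o \<Rightarrow> real) \<Rightarrow> bool" where
  "propagated_world SW NA S f g A' Y' \<longleftrightarrow>
     (\<forall>\<omega> \<in> space (Pr S).
        A' \<omega> = fA S (var_Z (intervene S f) \<omega>) (var_W S \<omega>) (UA S \<omega>) \<and>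
        Y' \<omega> = fY S (A' \<omega>) (var_W S \<omega>) (UY S \<omega>)) \<and>
     cond_density (Pr S) SW (var_W S) NA A' g"

end

theory Submission
  imports Defs
begin

text \<open>
  Conditional independence turns a density \<open>r\<close> of the law of \<open>(W, Z\<^sup>h)\<close> with respect to that of
  \<open>(W, Z)\<close> into the density \<open>r(w, z)\<close> of the law of \<open>(W, Z\<^sup>h, U\<^sub>A, U\<^sub>Y)\<close> with respect to that of
  \<open>(W, Z, U\<^sub>A, U\<^sub>Y)\<close>: for a fixed event \<open>U \<in> C\<close> both laws carry the same factor \<open>P(U \<in> C | W)\<close>, so no
  regular conditional distributions are needed. Pushing forward along the structural equations,
  the intervened law of \<open>(W, Z, A, Y)\<close> is the natural one reweighted by \<open>r\<close>. Since \<open>h\<close> and the law of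
  \<open>W\<close> determine the law of \<open>(W, Z\<^sup>h)\<close>, the case \<open>r = 1\<close> shows that within one model everything
  depends on \<open>h\<close> only, and under positivity the Radon-Nikodym derivative \<open>r\<close> is a function of \<open>P\<close>
  and \<open>h\<close>.
\<close>

section \<open>Equality of measures on a product and restriction to an event\<close>

lemma measure_eqI_pair:
  assumes "finite_measure M"
    and sM: "sets M = sets (A \<Otimes>\<^sub>M B)" and sN: "sets N = sets (A \<Otimes>\<^sub>M B)"
    and eq: "\<And>X Y. X \<in> sets A \<Longrightarrow> Y \<in> sets B \<Longrightarrow> emeasure M (X \<times> Y) = emeasure N (X \<times> Y)"
  shows "M = N"
\<comment> \<open>Rectangles form an intersection-stable generator of the product sigma-algebra.
  Finiteness of \<open>M\<close> lets the whole space serve as the constant exhausting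
  sequence.\<close>
proof (rule measure_eqI_generator_eq[where A = "\<lambda>_. space A \<times> space B"
      and E = "{X \<times> Y | X Y. X \<in> sets A \<and> Y \<in> sets B}" and \<Omega> = "space A \<times> space B"])
  interpret finite_measure M by fact
  show "Int_stable {X \<times> Y | X Y. X \<in> sets A \<and> Y \<in> sets B}"
    by (rule Int_stable_pair_measure_generator)
  show "{X \<times> Y | X Y. X \<in> sets A \<and> Y \<in> sets B} \<subseteq> Pow (space A \<times> space B)"
    by (rule pair_measure_closed)
  show "\<And>i. emeasure M (space A \<times> space B) \<noteq> \<infinity>" by simp
qed (auto simp: sM sN sets_pair_measure eq)

text \<open>\<open>density M (indicator E)\<close> is the unnormalised restriction of
  \<open>M\<close> to \<open>E\<close>. In this form a fixed event of the errors can be treated as a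
  change of measure on laws of \<open>(W, Z)\<close>.\<close>

lemma emeasure_distr_density_indicator:
  assumes [measurable]: "X \<in> M \<rightarrow>\<^sub>M N" "E \<in> sets M" "A \<in> sets N"
  shows "emeasure (distr (density M (indicator E)) N X) A = emeasure M (X -` A \<inter> space M \<inter> E)"
  by (simp add: emeasure_distr emeasure_density indicator_inter_arith[symmetric] Int_commute)

section \<open>Conditional probabilities, densities and independence given \<open>W\<close> as
  identities between laws\<close>

context prob_space
begin

lemma sigma_finite_subalgebra_vimage_algebra:
  assumes "W \<in> M \<rightarrow>\<^sub>M SW"
  shows "sigma_finite_subalgebra M (vimage_algebra (space M) W SW)"
proof -
  have "subalgebra M (vimage_algebra (space M) W SW)"
    unfolding subalgebra_def using assms measurable_space[OF assms]
    by (auto simp: sets_vimage_algebra2 Pi_iff)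
  then show ?thesis
    by (intro finite_measure_subalgebra_is_sigma_finite)
      (simp add: finite_measure_subalgebra_def finite_measure_subalgebra_axioms_def
        finite_measure_axioms)
qed

lemma cond_event_AE_iff:
  assumes [measurable]: "W \<in> M \<rightarrow>\<^sub>M SW" "E \<in> sets M" "u \<in> borel_measurable SW"
    and nonneg: "\<And>w. w \<in> space SW \<Longrightarrow> 0 \<le> u w"
  shows "(AE \<omega> in M. cond_event M SW W E \<omega> = u (W \<omega>)) \<longleftrightarrow>
    (\<forall>D \<in> sets SW. emeasure M (W -` D \<inter> space M \<inter> E) =
       (\<integral>\<^sup>+ w. ennreal (u w) * indicator D w \<partial>distr M SW W))"
proof -
  let ?F = "vimage_algebra (space M) W SW"
  interpret F: sigma_finite_subalgebra M ?F
    by (rule sigma_finite_subalgebra_vimage_algebra) fact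
  have W: "W \<in> space M \<rightarrow> space SW" by (auto dest: measurable_space[OF assms(1)])
  have uW[measurable]: "(\<lambda>\<omega>. u (W \<omega>)) \<in> borel_measurable ?F"
    by (rule measurable_compose[OF measurable_vimage_algebra1[OF W] assms(3)])
  have pos: "0 \<le> u (W \<omega>)" if "\<omega> \<in> space M" for \<omega> using W that nonneg by auto
  have iE: "integrable M (indicator E :: _ \<Rightarrow> real)"
    by (simp add: integrable_indicator_iff emeasure_finite less_top[symmetric])
  have lhs: "emeasure M (W -` D \<inter> space M \<inter> E) = ennreal (\<integral>\<omega>\<in>W -` D \<inter> space M. indicator E \<omega> \<partial>M)"
    if [measurable]: "D \<in> sets SW" for D
  proof -
    have "(\<integral>\<omega>\<in>W -` D \<inter> space M. indicator E \<omega> \<partial>M) = measure M (W -` D \<inter> space M \<inter> E)"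
      unfolding set_lebesgue_integral_def
      by (subst Bochner_Integration.integral_cong[OF refl, where g = "indicator (W -` D \<inter> space M \<inter> E)"])
        (auto simp: indicator_def)
    then show ?thesis by (simp add: emeasure_eq_measure)
  qed
  have rhs: "(\<integral>\<^sup>+ w. ennreal (u w) * indicator D w \<partial>distr M SW W) =
      (\<integral>\<^sup>+ \<omega>. ennreal (indicator (W -` D \<inter> space M) \<omega> * u (W \<omega>)) \<partial>M)"
    if [measurable]: "D \<in> sets SW" for D
    by (subst nn_integral_distr) (auto intro!: nn_integral_cong simp: indicator_def)
  show ?thesis
  proof
    assume ae: "AE \<omega> in M. cond_event M SW W E \<omega> = u (W \<omega>)"
    have iu: "integrable M (\<lambda>\<omega>. u (W \<omega>))"
      using F.real_cond_exp_int(1)[OF iE] ae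
      by (subst integrable_cong_AE[where g = "cond_event M SW W E"])
        (auto simp: cond_event_def)
    show "\<forall>D \<in> sets SW. emeasure M (W -` D \<inter> space M \<inter> E) =
       (\<integral>\<^sup>+ w. ennreal (u w) * indicator D w \<partial>distr M SW W)"
    proof
      fix D assume [measurable]: "D \<in> sets SW"
      have "(\<integral>\<omega>\<in>W -` D \<inter> space M. indicator E \<omega> \<partial>M) =
          (\<integral>\<omega>\<in>W -` D \<inter> space M. cond_event M SW W E \<omega> \<partial>M)"
        unfolding cond_event_def by (rule F.real_cond_exp_intA[OF iE]) (auto intro: in_vimage_algebra)
      also have "\<dots> = (\<integral>\<omega>. indicator (W -` D \<inter> space M) \<omega> * u (W \<omega>) \<partial>M)"
        unfolding set_lebesgue_integral_def using ae
        by (intro integral_cong_AE) (auto simp: cond_event_def)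
      finally show "emeasure M (W -` D \<inter> space M \<inter> E) =
          (\<integral>\<^sup>+ w. ennreal (u w) * indicator D w \<partial>distr M SW W)"
        unfolding lhs[OF \<open>D \<in> sets SW\<close>] rhs[OF \<open>D \<in> sets SW\<close>]
        using iu pos by (subst nn_integral_eq_integral)
          (auto intro!: integrable_real_mult_indicator AE_I2 simp: mult.commute)
    qed
  next
    assume eq: "\<forall>D \<in> sets SW. emeasure M (W -` D \<inter> space M \<inter> E) =
       (\<integral>\<^sup>+ w. ennreal (u w) * indicator D w \<partial>distr M SW W)"
    \<comment> \<open>Integrability comes from the criterion itself: for \<open>D = space SW\<close>
      its left side is a probability, hence finite.\<close>
    have iu: "integrable M (\<lambda>\<omega>. u (W \<omega>))"
    proof (rule integrableI_nonneg)
      have "(\<integral>\<^sup>+ \<omega>. ennreal (u (W \<omega>)) \<partial>M) =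
          (\<integral>\<^sup>+ w. ennreal (u w) * indicator (space SW) w \<partial>distr M SW W)"
        using W by (subst nn_integral_distr) (auto intro!: nn_integral_cong simp: Pi_iff)
      also have "\<dots> = emeasure M (W -` space SW \<inter> space M \<inter> E)" using eq by simp
      finally show "(\<integral>\<^sup>+ \<omega>. ennreal (u (W \<omega>)) \<partial>M) < \<infinity>"
        by (simp add: emeasure_finite less_top[symmetric])
    qed (use pos in \<open>auto intro!: AE_I2\<close>)
    show "AE \<omega> in M. cond_event M SW W E \<omega> = u (W \<omega>)"
      unfolding cond_event_def
    proof (rule F.real_cond_exp_charact[OF _ iE iu uW])
      fix A assume "A \<in> sets ?F"
      then obtain D where D[measurable]: "D \<in> sets SW" and A: "A = W -` D \<inter> space M"
        using W by (auto simp: sets_vimage_algebra2)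
      have "ennreal (\<integral>\<omega>\<in>A. indicator E \<omega> \<partial>M) =
          ennreal (\<integral>\<omega>. indicator A \<omega> * u (W \<omega>) \<partial>M)"
        using bspec[OF eq D] unfolding lhs[OF D] rhs[OF D] A
        using iu pos by (subst (asm) nn_integral_eq_integral)
          (auto intro!: integrable_real_mult_indicator AE_I2 simp: mult.commute)
      then show "(\<integral>\<omega>\<in>A. indicator E \<omega> \<partial>M) = (\<integral>\<omega>\<in>A. u (W \<omega>) \<partial>M)"
        unfolding set_lebesgue_integral_def using pos
        by (subst (asm) ennreal_inj)
          (auto intro!: integral_nonneg_AE AE_I2 simp: indicator_def)
    qed
  qed
qed

text \<open>By Tonelli, the conditional identities for all \<open>B\<close> say that two measures
  agree on all rectangles \<open>D \<times> B\<close>, hence everywhere. The exceptional null sets,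
  one for each \<open>B\<close>, are thereby absorbed into a single equation between laws.\<close>

lemma cond_density_iff_law:
  assumes [measurable]: "W \<in> M \<rightarrow>\<^sub>M SW" "X \<in> M \<rightarrow>\<^sub>M N" and "sigma_finite_measure N"
  shows "cond_density M SW W N X q \<longleftrightarrow> density_kernel SW N q \<and>
    distr M (SW \<Otimes>\<^sub>M N) (\<lambda>\<omega>. (W \<omega>, X \<omega>)) =
      density (distr M SW W \<Otimes>\<^sub>M N) (\<lambda>(w, x). ennreal (q w x))"
proof (cases "density_kernel SW N q")
  case True
  interpret N: sigma_finite_measure N by fact
  have m[measurable]: "(\<lambda>(w, x). q w x) \<in> borel_measurable (SW \<Otimes>\<^sub>M N)"
    and pos: "\<And>w x. w \<in> space SW \<Longrightarrow> x \<in> space N \<Longrightarrow> 0 \<le> q w x"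
    and one: "\<And>w. w \<in> space SW \<Longrightarrow> (\<integral>\<^sup>+ x. ennreal (q w x) \<partial>N) = 1"
    using True by (auto simp: density_kernel_def)
  let ?L = "distr M (SW \<Otimes>\<^sub>M N) (\<lambda>\<omega>. (W \<omega>, X \<omega>))"
  let ?R = "density (distr M SW W \<Otimes>\<^sub>M N) (\<lambda>(w, x). ennreal (q w x))"
  define u where "u B w = (LINT x:B|N. q w x)" for B w
  have [measurable]: "u B \<in> borel_measurable SW" if [measurable]: "B \<in> sets N" for B
    unfolding u_def set_lebesgue_integral_def by measurable
  have u_nonneg: "0 \<le> u B w" if "w \<in> space SW" for B w
    unfolding u_def set_lebesgue_integral_def using that pos
    by (intro Bochner_Integration.integral_nonneg) auto
  have u_eq: "ennreal (u B w) = (\<integral>\<^sup>+ x. ennreal (q w x) * indicator B x \<partial>N)"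
    if w: "w \<in> space SW" and [measurable]: "B \<in> sets N" for B w
  proof -
    have [measurable]: "q w \<in> borel_measurable N"
      using measurable_Pair2[OF m w] by simp
    \<comment> \<open>Total mass 1 makes the Bochner integral in \<open>u\<close> a genuine integral
      rather than the default value 0.\<close>
    have "integrable N (q w)"
      by (rule integrableI_nonneg) (use one[OF w] pos[OF w] in \<open>auto intro!: AE_I2\<close>)
    then have "integrable N (\<lambda>x. q w x * indicator B x)"
      by (rule integrable_real_mult_indicator[rotated]) simp
    then have "(\<integral>\<^sup>+ x. ennreal (q w x * indicator B x) \<partial>N) = ennreal (u B w)"
      unfolding u_def set_lebesgue_integral_def using pos[OF w]
      by (subst nn_integral_eq_integral) (auto intro!: AE_I2 simp: mult.commute)
    moreover have "(\<integral>\<^sup>+ x. ennreal (q w x * indicator B x) \<partial>N) =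
        (\<integral>\<^sup>+ x. ennreal (q w x) * indicator B x \<partial>N)"
      by (intro nn_integral_cong) (auto split: split_indicator)
    ultimately show ?thesis by simp
  qed
  have L: "emeasure ?L (D \<times> B) = emeasure M (W -` D \<inter> space M \<inter> (X -` B \<inter> space M))"
    if [measurable]: "D \<in> sets SW" "B \<in> sets N" for D B
    by (subst emeasure_distr) (auto intro!: arg_cong[where f = "emeasure M"])
  have R: "emeasure ?R (D \<times> B) = (\<integral>\<^sup>+ w. ennreal (u B w) * indicator D w \<partial>distr M SW W)"
    if [measurable]: "D \<in> sets SW" "B \<in> sets N" for D B
  proof -
    have "emeasure ?R (D \<times> B) =
        (\<integral>\<^sup>+ w. \<integral>\<^sup>+ x. ennreal (q w x) * indicator (D \<times> B) (w, x) \<partial>N \<partial>distr M SW W)"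
      by (subst emeasure_density) (auto simp: N.nn_integral_fst[symmetric] split_beta')
    also have "\<dots> = (\<integral>\<^sup>+ w. ennreal (u B w) * indicator D w \<partial>distr M SW W)"
      by (intro nn_integral_cong) (auto simp: u_eq indicator_times split: split_indicator)
    finally show ?thesis .
  qed
  have "cond_density M SW W N X q \<longleftrightarrow>
      (\<forall>B \<in> sets N. \<forall>D \<in> sets SW. emeasure ?L (D \<times> B) = emeasure ?R (D \<times> B))"
    unfolding cond_density_def u_def[symmetric] using True
    by (auto simp: cond_event_AE_iff u_nonneg L R)
  also have "\<dots> \<longleftrightarrow> ?L = ?R"
  proof safe
    assume "\<forall>B \<in> sets N. \<forall>D \<in> sets SW. emeasure ?L (D \<times> B) = emeasure ?R (D \<times> B)"
    then show "?L = ?R"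
      by (intro measure_eqI_pair[where A = SW and B = N] finite_measure_distr)
        (auto intro!: sets_pair_measure_cong)
  qed simp
  finally show ?thesis using True by simp
qed (simp add: cond_density_def)

text \<open>Conditioning on \<open>W\<close> splits the joint probability of \<open>Z\<close> in
  \<open>B\<close> and \<open>V\<close> in \<open>C\<close> into a product, and
  \<open>k (W \<omega>)\<close> can be moved out of the conditional expectation. Restricting to
  \<open>V\<close> in \<open>C\<close> thus weights the law of \<open>(W, Z)\<close> by a function
  of \<open>W\<close> alone.\<close>

lemma cond_indep_given_law:
  assumes [measurable]: "W \<in> M \<rightarrow>\<^sub>M SW" "Z \<in> M \<rightarrow>\<^sub>M NZ" "V \<in> M \<rightarrow>\<^sub>M SV" "C \<in> sets SV"
    and [measurable]: "k \<in> borel_measurable SW" and nonneg: "\<And>w. w \<in> space SW \<Longrightarrow> 0 \<le> k w"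
    and indep: "cond_indep_given M SW W NZ Z SV V"
    and k: "AE \<omega> in M. cond_event M SW W (V -` C \<inter> space M) \<omega> = k (W \<omega>)"
  shows "distr (density M (indicator (V -` C \<inter> space M))) (SW \<Otimes>\<^sub>M NZ) (\<lambda>\<omega>. (W \<omega>, Z \<omega>)) =
    density (distr M (SW \<Otimes>\<^sub>M NZ) (\<lambda>\<omega>. (W \<omega>, Z \<omega>))) (\<lambda>x. ennreal (k (fst x)))"
    (is "?L = ?R")
proof (rule measure_eqI_pair[where A = SW and B = NZ])
  let ?F = "vimage_algebra (space M) W SW"
  let ?C = "V -` C \<inter> space M"
  interpret F: sigma_finite_subalgebra M ?F
    by (rule sigma_finite_subalgebra_vimage_algebra) fact
  have W: "W \<in> space M \<rightarrow> space SW" by (auto dest: measurable_space[OF assms(1)])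
  show "finite_measure ?L"
    by (rule finite_measureI) (simp add: emeasure_distr_density_indicator emeasure_finite)
  fix D B assume [measurable]: "D \<in> sets SW" "B \<in> sets NZ"
  let ?B = "Z -` B \<inter> space M" and ?D = "W -` D \<inter> space M"
  have kW[measurable]: "(\<lambda>\<omega>. k (W \<omega>)) \<in> borel_measurable ?F"
    by (rule measurable_compose[OF measurable_vimage_algebra1[OF W]]) simp
  have DF[measurable]: "?D \<in> sets ?F" by (auto intro: in_vimage_algebra)
  have i: "integrable M (indicator E :: _ \<Rightarrow> real)" if "E \<in> sets M" for E
    using that by (simp add: integrable_indicator_iff emeasure_finite less_top[symmetric])
  have "integrable M (cond_event M SW W ?C)"
    unfolding cond_event_def by (rule F.real_cond_exp_int[OF i]) simp
  then have ik: "integrable M (\<lambda>\<omega>. k (W \<omega>))"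
    using k by (subst integrable_cong_AE[where g = "cond_event M SW W ?C"])
      (auto simp: cond_event_def)
  then have "integrable M (\<lambda>\<omega>. k (W \<omega>) * indicator (?D \<inter> ?B) \<omega>)"
    by (rule integrable_real_mult_indicator[rotated]) simp
  then have ikDB: "integrable M (\<lambda>\<omega>. indicator ?D \<omega> * k (W \<omega>) * indicator ?B \<omega>)"
    by (rule back_subst[where P = "integrable M"]) (auto split: split_indicator)
  have "measure M (?D \<inter> (?B \<inter> ?C)) = (\<integral>\<omega>\<in>?D. indicator (?B \<inter> ?C) \<omega> \<partial>M)"
    unfolding set_lebesgue_integral_def
    by (subst Bochner_Integration.integral_cong[OF refl, where g = "indicator (?D \<inter> (?B \<inter> ?C))"])
      (auto simp: indicator_def)
  also have "\<dots> = (\<integral>\<omega>\<in>?D. cond_event M SW W (?B \<inter> ?C) \<omega> \<partial>M)"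
    unfolding cond_event_def by (rule F.real_cond_exp_intA[OF i]) auto
  \<comment> \<open>Conditional independence enters here, with the second factor replaced by its
    version \<open>k\<close>.\<close>
  also have "\<dots> = (\<integral>\<omega>. indicator ?D \<omega> * k (W \<omega>) * cond_event M SW W ?B \<omega> \<partial>M)"
  proof -
    have "AE \<omega> in M. cond_event M SW W (?B \<inter> ?C) \<omega> = cond_event M SW W ?B \<omega> * k (W \<omega>)"
      using bspec[OF bspec[OF indep[unfolded cond_indep_given_def] \<open>B \<in> sets NZ\<close>]
          \<open>C \<in> sets SV\<close>] k
      by eventually_elim simp
    then show ?thesis
      unfolding set_lebesgue_integral_def
      by (intro integral_cong_AE) (auto simp: cond_event_def)
  qed
  \<comment> \<open>The weight in front is measurable with respect to \<open>W\<close>, so the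
    conditional probability of \<open>?B\<close> may be replaced by the indicator of
    \<open>?B\<close>.\<close>
  also have "\<dots> = (\<integral>\<omega>. indicator ?D \<omega> * k (W \<omega>) * indicator ?B \<omega> \<partial>M)"
    unfolding cond_event_def by (rule F.real_cond_exp_intg(2)[OF ikDB]) auto
  finally have "emeasure M (?D \<inter> (?B \<inter> ?C)) =
      (\<integral>\<^sup>+ \<omega>. ennreal (indicator ?D \<omega> * k (W \<omega>) * indicator ?B \<omega>) \<partial>M)"
    using ikDB W nonneg by (subst nn_integral_eq_integral)
      (auto simp: emeasure_eq_measure Pi_iff intro!: AE_I2)
  also have "\<dots> = emeasure ?R (D \<times> B)"
    by (auto simp: emeasure_density nn_integral_distr intro!: nn_integral_cong split: split_indicator)
  finally show "emeasure ?L (D \<times> B) = emeasure ?R (D \<times> B)"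
    by (auto simp: emeasure_distr_density_indicator elim!: trans[rotated]
      intro!: arg_cong[where f = "emeasure M"])
qed auto

text \<open>The Radon-Nikodym derivative of the law of \<open>W\<close> restricted to
  \<open>E\<close>, taken against the full law of \<open>W\<close>, lives on the value space of
  \<open>W\<close>. It thus gives the conditional probability as a function of
  \<open>W\<close>.\<close>

lemma cond_event_factor:
  assumes [measurable]: "W \<in> M \<rightarrow>\<^sub>M SW" "E \<in> sets M"
  obtains k where "k \<in> borel_measurable SW" "\<And>w. 0 \<le> k w"
    "AE \<omega> in M. cond_event M SW W E \<omega> = k (W \<omega>)"
proof -
  let ?\<mu> = "distr M SW W" and ?\<nu> = "distr (density M (indicator E)) SW W"
  interpret \<mu>: prob_space ?\<mu> by (rule prob_space_distr) simp
  have \<nu>: "emeasure ?\<nu> D = emeasure M (W -` D \<inter> space M \<inter> E)" if [measurable]: "D \<in> sets SW" for D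
    by (rule emeasure_distr_density_indicator) simp_all
  have fin: "finite_measure ?\<nu>"
    by (rule finite_measureI) (simp add: \<nu> emeasure_finite)
  have ac: "absolutely_continuous ?\<mu> ?\<nu>"
    unfolding absolutely_continuous_def
  proof safe
    fix D assume "D \<in> null_sets ?\<mu>"
    then have D[measurable]: "D \<in> sets SW" and "emeasure M (W -` D \<inter> space M) = 0"
      by (auto simp: null_sets_def emeasure_distr)
    then have "emeasure M (W -` D \<inter> space M \<inter> E) = 0"
      using emeasure_mono[of "W -` D \<inter> space M \<inter> E" "W -` D \<inter> space M" M] by (simp add: le_infI1)
    then show "D \<in> null_sets ?\<nu>" using \<nu>[OF D] by (auto simp: null_sets_def)
  qed
  \<comment> \<open>Finiteness of \<open>?\<nu>\<close> yields a real-valued version of the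
    derivative that is nonnegative everywhere.\<close>
  obtain k where k[measurable]: "k \<in> borel_measurable ?\<mu>"
    and RN: "AE w in ?\<mu>. RN_deriv ?\<mu> ?\<nu> w = ennreal (k w)" and nonneg: "\<And>w. 0 \<le> k w"
    by (rule \<mu>.real_RN_deriv[OF fin ac]) auto
  show thesis
  proof
    show "k \<in> borel_measurable SW" using k by simp
    have "emeasure M (W -` D \<inter> space M \<inter> E) = (\<integral>\<^sup>+ w. ennreal (k w) * indicator D w \<partial>?\<mu>)"
      if D[measurable]: "D \<in> sets SW" for D
    proof -
      have "emeasure M (W -` D \<inter> space M \<inter> E) = emeasure (density ?\<mu> (RN_deriv ?\<mu> ?\<nu>)) D"
        using \<nu>[OF D] \<mu>.density_RN_deriv[OF ac] by simp
      also have "\<dots> = (\<integral>\<^sup>+ w. ennreal (k w) * indicator D w \<partial>?\<mu>)"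
        using RN by (subst emeasure_density) (auto intro!: nn_integral_cong_AE)
      finally show ?thesis .
    qed
    then show "AE \<omega> in M. cond_event M SW W E \<omega> = k (W \<omega>)"
      using nonneg by (subst cond_event_AE_iff) auto
  qed (rule nonneg)
qed

lemma cond_indep_given_change_density:
  assumes [measurable]: "W \<in> M \<rightarrow>\<^sub>M SW" "Z \<in> M \<rightarrow>\<^sub>M NZ" "Z' \<in> M \<rightarrow>\<^sub>M NZ" "V \<in> M \<rightarrow>\<^sub>M SV"
    and [measurable]: "r \<in> borel_measurable (SW \<Otimes>\<^sub>M NZ)"
    and indep: "cond_indep_given M SW W NZ Z SV V" "cond_indep_given M SW W NZ Z' SV V"
    and r: "distr M (SW \<Otimes>\<^sub>M NZ) (\<lambda>\<omega>. (W \<omega>, Z' \<omega>)) =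
      density (distr M (SW \<Otimes>\<^sub>M NZ) (\<lambda>\<omega>. (W \<omega>, Z \<omega>))) r"
  shows "distr M ((SW \<Otimes>\<^sub>M NZ) \<Otimes>\<^sub>M SV) (\<lambda>\<omega>. ((W \<omega>, Z' \<omega>), V \<omega>)) =
    density (distr M ((SW \<Otimes>\<^sub>M NZ) \<Otimes>\<^sub>M SV) (\<lambda>\<omega>. ((W \<omega>, Z \<omega>), V \<omega>))) (\<lambda>x. r (fst x))"
    (is "?L = ?R")
proof (rule measure_eqI_pair[where A = "SW \<Otimes>\<^sub>M NZ" and B = SV])
  show "finite_measure ?L" by (rule finite_measure_distr) simp
  fix E C assume [measurable]: "E \<in> sets (SW \<Otimes>\<^sub>M NZ)" "C \<in> sets SV"
  let ?P = "SW \<Otimes>\<^sub>M NZ" and ?M = "density M (indicator (V -` C \<inter> space M))"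
  \<comment> \<open>This \<open>k\<close> is chosen from \<open>W\<close> and the event
    \<open>V\<close> in \<open>C\<close> only, so the same weight serves for \<open>Z\<close> and
    for \<open>Z'\<close>.\<close>
  obtain k where [measurable]: "k \<in> borel_measurable SW" and nonneg: "\<And>w. 0 \<le> k w"
    and k: "AE \<omega> in M. cond_event M SW W (V -` C \<inter> space M) \<omega> = k (W \<omega>)"
    by (rule cond_event_factor[of W SW "V -` C \<inter> space M"]) auto
  have law: "distr ?M ?P (\<lambda>\<omega>. (W \<omega>, Z \<omega>)) =
      density (distr M ?P (\<lambda>\<omega>. (W \<omega>, Z \<omega>))) (\<lambda>x. ennreal (k (fst x)))"
    "distr ?M ?P (\<lambda>\<omega>. (W \<omega>, Z' \<omega>)) =
      density (distr M ?P (\<lambda>\<omega>. (W \<omega>, Z' \<omega>))) (\<lambda>x. ennreal (k (fst x)))"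
    by (rule cond_indep_given_law[OF _ _ _ _ _ nonneg _ k], fact+)+
  have "emeasure ?L (E \<times> C) = emeasure (distr ?M ?P (\<lambda>\<omega>. (W \<omega>, Z' \<omega>))) E"
    by (subst emeasure_distr_density_indicator)
      (auto simp: emeasure_distr intro!: arg_cong[where f = "emeasure M"])
  \<comment> \<open>Successive densities multiply, so the weights \<open>k\<close> and
    \<open>r\<close> can be interchanged.\<close>
  also have "distr ?M ?P (\<lambda>\<omega>. (W \<omega>, Z' \<omega>)) = density (distr ?M ?P (\<lambda>\<omega>. (W \<omega>, Z \<omega>))) r"
    unfolding law r by (simp add: density_density_eq mult.commute)
  also have "emeasure \<dots> E = emeasure ?R (E \<times> C)"
    by (auto simp: emeasure_density nn_integral_distr nn_integral_density
      intro!: nn_integral_cong split: split_indicator)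
  finally show "emeasure ?L (E \<times> C) = emeasure ?R (E \<times> C)" .
qed auto

end

text \<open>Having a given conditional density is a property of the joint law by
  \<open>cond_density_iff_law\<close>, and the joint law is the same on both probability
  spaces.\<close>

lemma cond_density_distr:
  assumes [measurable]: "T \<in> M \<rightarrow>\<^sub>M K" "W \<in> K \<rightarrow>\<^sub>M SW" "X \<in> K \<rightarrow>\<^sub>M N"
    and M: "prob_space M" and N: "sigma_finite_measure N"
  shows "cond_density (distr M K T) SW W N X q \<longleftrightarrow>
    cond_density M SW (\<lambda>\<omega>. W (T \<omega>)) N (\<lambda>\<omega>. X (T \<omega>)) q"
proof -
  interpret M: prob_space M by fact
  interpret L: prob_space "distr M K T" by (rule M.prob_space_distr) simp
  show ?thesis
    by (simp add: L.cond_density_iff_law M.cond_density_iff_law N distr_distr comp_def)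
qed

section \<open>The structural model downstream of the instrument\<close>

lemma intervene_simps [simp]:
  "Pr (intervene S f) = Pr S" "SUA (intervene S f) = SUA S" "SUY (intervene S f) = SUY S"
  "UA (intervene S f) = UA S" "UY (intervene S f) = UY S"
  "fA (intervene S f) = fA S" "fY (intervene S f) = fY S"
  "var_W (intervene S f) = var_W S"
  by (simp_all add: intervene_def var_W_def fun_eq_iff)

lemma iv_scm_measurable:
  assumes "iv_scm SW NZ NA S"
  shows "var_W S \<in> Pr S \<rightarrow>\<^sub>M SW" "var_Z S \<in> Pr S \<rightarrow>\<^sub>M NZ" "var_A S \<in> Pr S \<rightarrow>\<^sub>M NA"
    "var_Y S \<in> borel_measurable (Pr S)" "UA S \<in> Pr S \<rightarrow>\<^sub>M SUA S" "UY S \<in> Pr S \<rightarrow>\<^sub>M SUY S"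
proof -
  have [measurable]: "UW S \<in> Pr S \<rightarrow>\<^sub>M SUW S" "UZ S \<in> Pr S \<rightarrow>\<^sub>M SUZ S"
      "fW S \<in> SUW S \<rightarrow>\<^sub>M SW"
    and U[measurable]: "UA S \<in> Pr S \<rightarrow>\<^sub>M SUA S" "UY S \<in> Pr S \<rightarrow>\<^sub>M SUY S"
    and f: "(\<lambda>(w, u). fZ S w u) \<in> SW \<Otimes>\<^sub>M SUZ S \<rightarrow>\<^sub>M NZ"
      "(\<lambda>(z, w, u). fA S z w u) \<in> NZ \<Otimes>\<^sub>M SW \<Otimes>\<^sub>M SUA S \<rightarrow>\<^sub>M NA"
      "(\<lambda>(a, w, u). fY S a w u) \<in> NA \<Otimes>\<^sub>M SW \<Otimes>\<^sub>M SUY S \<rightarrow>\<^sub>M borel"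
    using assms by (auto simp: iv_scm_def)
  show W[measurable]: "var_W S \<in> Pr S \<rightarrow>\<^sub>M SW"
    unfolding var_W_def[abs_def] by measurable
  have "(\<lambda>\<omega>. (var_W S \<omega>, UZ S \<omega>)) \<in> Pr S \<rightarrow>\<^sub>M SW \<Otimes>\<^sub>M SUZ S" by measurable
  from measurable_compose[OF this f(1)] show Z[measurable]: "var_Z S \<in> Pr S \<rightarrow>\<^sub>M NZ"
    by (simp add: var_Z_def[abs_def])
  have "(\<lambda>\<omega>. (var_Z S \<omega>, var_W S \<omega>, UA S \<omega>)) \<in> Pr S \<rightarrow>\<^sub>M NZ \<Otimes>\<^sub>M SW \<Otimes>\<^sub>M SUA S" by measurable
  from measurable_compose[OF this f(2)] show A[measurable]: "var_A S \<in> Pr S \<rightarrow>\<^sub>M NA"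
    by (simp add: var_A_def[abs_def])
  have "(\<lambda>\<omega>. (var_A S \<omega>, var_W S \<omega>, UY S \<omega>)) \<in> Pr S \<rightarrow>\<^sub>M NA \<Otimes>\<^sub>M SW \<Otimes>\<^sub>M SUY S" by measurable
  from measurable_compose[OF this f(3)] show "var_Y S \<in> borel_measurable (Pr S)"
    by (simp add: var_Y_def[abs_def])
qed (use assms in \<open>auto simp: iv_scm_def\<close>)

text \<open>This is the mechanism after the instrument, deterministic once the errors are given. It
  does not involve \<open>fZ\<close>, so all interventions share it; its argument is grouped as
  \<open>(W, Z)\<close> and errors to fit \<open>cond_indep_given_change_density\<close>.\<close>

definition response_map :: "('o, 'uw, 'uz, 'ua, 'uy, 'w, 'z, 'a) iv_scm \<Rightarrow>
    ('w \<times> 'z) \<times> 'ua \<times> 'uy \<Rightarrow> 'w \<times> 'z \<times> 'a \<times> real" where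
  "response_map S = (\<lambda>((w, z), ua, uy). (w, z, fA S z w ua, fY S (fA S z w ua) w uy))"

lemma measurable_response_map:
  assumes "iv_scm SW NZ NA S"
  shows "response_map S \<in> (SW \<Otimes>\<^sub>M NZ) \<Otimes>\<^sub>M SUA S \<Otimes>\<^sub>M SUY S \<rightarrow>\<^sub>M SW \<Otimes>\<^sub>M NZ \<Otimes>\<^sub>M NA \<Otimes>\<^sub>M borel"
proof -
  let ?K = "(SW \<Otimes>\<^sub>M NZ) \<Otimes>\<^sub>M SUA S \<Otimes>\<^sub>M SUY S"
  let ?a = "\<lambda>x. fA S (snd (fst x)) (fst (fst x)) (fst (snd x))"
  have f: "(\<lambda>(z, w, u). fA S z w u) \<in> NZ \<Otimes>\<^sub>M SW \<Otimes>\<^sub>M SUA S \<rightarrow>\<^sub>M NA"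
      "(\<lambda>(a, w, u). fY S a w u) \<in> NA \<Otimes>\<^sub>M SW \<Otimes>\<^sub>M SUY S \<rightarrow>\<^sub>M borel"
    using assms by (auto simp: iv_scm_def)
  have "(\<lambda>x. (snd (fst x), fst (fst x), fst (snd x))) \<in> ?K \<rightarrow>\<^sub>M NZ \<Otimes>\<^sub>M SW \<Otimes>\<^sub>M SUA S" by measurable
  from measurable_compose[OF this f(1)] have a[measurable]: "?a \<in> ?K \<rightarrow>\<^sub>M NA" by simp
  have "(\<lambda>x. (?a x, fst (fst x), snd (snd x))) \<in> ?K \<rightarrow>\<^sub>M NA \<Otimes>\<^sub>M SW \<Otimes>\<^sub>M SUY S" by measurable
  from measurable_compose[OF this f(2)]
  have [measurable]: "(\<lambda>x. fY S (?a x) (fst (fst x)) (snd (snd x))) \<in> borel_measurable ?K" by simp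
  have "response_map S =
      (\<lambda>x. (fst (fst x), snd (fst x), ?a x, fY S (?a x) (fst (fst x)) (snd (snd x))))"
    by (auto simp: response_map_def)
  then show ?thesis by simp
qed

lemma response_map_intervene [simp]: "response_map (intervene S f) = response_map S"
  by (simp add: response_map_def)

lemma observed_law_response_map:
  assumes "iv_scm SW NZ NA (intervene S f)"
  shows "observed_law SW NZ NA (intervene S f) =
    distr (distr (Pr S) ((SW \<Otimes>\<^sub>M NZ) \<Otimes>\<^sub>M SUA S \<Otimes>\<^sub>M SUY S)
      (\<lambda>\<omega>. ((var_W S \<omega>, var_Z (intervene S f) \<omega>), UA S \<omega>, UY S \<omega>)))
      (SW \<Otimes>\<^sub>M NZ \<Otimes>\<^sub>M NA \<Otimes>\<^sub>M borel) (response_map S)"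
proof -
  note [measurable] = iv_scm_measurable[OF assms, simplified]
    measurable_response_map[OF assms, simplified]
  have "response_map S ((var_W S \<omega>, var_Z (intervene S f) \<omega>), UA S \<omega>, UY S \<omega>) =
      (var_W S \<omega>, var_Z (intervene S f) \<omega>, var_A (intervene S f) \<omega>, var_Y (intervene S f) \<omega>)" for \<omega>
    by (simp add: response_map_def var_A_def var_Y_def)
  then show ?thesis
    by (subst distr_distr) (simp_all add: observed_law_def comp_def)
qed

section \<open>Reweighting from one intervention to another\<close>

lemma intervene_fZ: "intervene S (fZ S) = S"
  by (simp add: intervene_def)

text \<open>Both worlds push a law of \<open>(W, Z, U_A, U_Y)\<close> through the same
  \<open>response_map\<close>. Their laws before this map differ by the factor \<open>r\<close>,
  which the map preserves because it copies \<open>w\<close> and \<open>z\<close>.\<close>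

lemma observed_law_change_density:
  assumes scm: "iv_scm SW NZ NA (intervene S f)" "iv_scm SW NZ NA (intervene S f')"
    and indep: "cond_indep_given (Pr S) SW (var_W S) NZ (var_Z (intervene S f))
        (SUA S \<Otimes>\<^sub>M SUY S) (\<lambda>\<omega>. (UA S \<omega>, UY S \<omega>))"
      "cond_indep_given (Pr S) SW (var_W S) NZ (var_Z (intervene S f'))
        (SUA S \<Otimes>\<^sub>M SUY S) (\<lambda>\<omega>. (UA S \<omega>, UY S \<omega>))"
    and r_meas[measurable]: "r \<in> borel_measurable (SW \<Otimes>\<^sub>M NZ)"
    and r: "distr (Pr S) (SW \<Otimes>\<^sub>M NZ) (\<lambda>\<omega>. (var_W S \<omega>, var_Z (intervene S f') \<omega>)) =
      density (distr (Pr S) (SW \<Otimes>\<^sub>M NZ) (\<lambda>\<omega>. (var_W S \<omega>, var_Z (intervene S f) \<omega>))) r"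
  shows "observed_law SW NZ NA (intervene S f') =
    density (observed_law SW NZ NA (intervene S f)) (\<lambda>(w, z, a, y). r (w, z))"
proof -
  interpret prob_space "Pr S" using scm(1) by (simp add: iv_scm_def)
  note [measurable] = iv_scm_measurable[OF scm(1), simplified]
    iv_scm_measurable(2)[OF scm(2), simplified]
    measurable_response_map[OF scm(1), simplified]
  have "distr (Pr S) ((SW \<Otimes>\<^sub>M NZ) \<Otimes>\<^sub>M SUA S \<Otimes>\<^sub>M SUY S)
      (\<lambda>\<omega>. ((var_W S \<omega>, var_Z (intervene S f') \<omega>), UA S \<omega>, UY S \<omega>)) =
    density (distr (Pr S) ((SW \<Otimes>\<^sub>M NZ) \<Otimes>\<^sub>M SUA S \<Otimes>\<^sub>M SUY S)
      (\<lambda>\<omega>. ((var_W S \<omega>, var_Z (intervene S f) \<omega>), UA S \<omega>, UY S \<omega>))) (\<lambda>x. r (fst x))"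
    by (rule cond_indep_given_change_density[OF _ _ _ _ r_meas indep r]) measurable
  \<comment> \<open>The weight after \<open>response_map\<close> pulls back to the weight before it,
    which is what \<open>density_distr\<close> requires.\<close>
  moreover have "r (fst (response_map S x), fst (snd (response_map S x))) = r (fst x)" for x
    by (simp add: response_map_def split_beta')
  ultimately show ?thesis
    unfolding observed_law_response_map[OF scm(1)] observed_law_response_map[OF scm(2)]
    by (subst density_distr) (simp_all add: split_beta')
qed

text \<open>This allows the treatment marginal to be read off the law of the four variables
  alone.\<close>

lemma cond_density_observed_law:
  assumes "iv_scm SW NZ NA S" "sigma_finite_measure NA"
  shows "cond_density (observed_law SW NZ NA S) SW fst NA (\<lambda>(w, z, a, y). a) q \<longleftrightarrow>
    cond_density (Pr S) SW (var_W S) NA (var_A S) q"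
proof -
  note [measurable] = iv_scm_measurable[OF assms(1)]
  show ?thesis
    unfolding observed_law_def split_beta'
    using assms by (subst cond_density_distr) (auto simp: iv_scm_def)
qed

lemma integral_observed_law:
  assumes "iv_scm SW NZ NA S"
  shows "(LINT (w, z, a, y)|observed_law SW NZ NA S. y) = (LINT \<omega>|Pr S. var_Y S \<omega>)"
proof -
  note [measurable] = iv_scm_measurable[OF assms]
  show ?thesis unfolding observed_law_def split_beta' by (subst integral_distr) simp_all
qed

section \<open>Identification of the intervened law\<close>

lemma instrument_law_intervene:
  assumes "iv_scm SW NZ NA (intervene S f)" "sigma_finite_measure NZ"
    and "cond_density (Pr S) SW (var_W S) NZ (var_Z (intervene S f)) h"
  shows "distr (Pr S) (SW \<Otimes>\<^sub>M NZ) (\<lambda>\<omega>. (var_W S \<omega>, var_Z (intervene S f) \<omega>)) =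
    density (distr (Pr S) SW (var_W S) \<Otimes>\<^sub>M NZ) (\<lambda>(w, z). ennreal (h w z))"
proof -
  interpret prob_space "Pr S" using assms(1) by (simp add: iv_scm_def)
  note [measurable] = iv_scm_measurable[OF assms(1), simplified]
  show ?thesis using assms by (simp add: cond_density_iff_law)
qed

lemma observed_law_intervene_unique:
  assumes "iv_intervention SW NZ NA S f h g" "iv_intervention SW NZ NA S f' h g'"
  shows "observed_law SW NZ NA (intervene S f') = observed_law SW NZ NA (intervene S f)"
proof -
  \<comment> \<open>The weight 1 is written as a function applied to \<open>(w, z)\<close> so that
    it has the shape of \<open>r\<close> in \<open>observed_law_change_density\<close>.\<close>
  have "observed_law SW NZ NA (intervene S f') =
      density (observed_law SW NZ NA (intervene S f)) (\<lambda>(w, z, a, y). (\<lambda>_. 1) (w, z))"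
    using assms unfolding iv_intervention_def
    by (intro observed_law_change_density)
      (auto simp: density_1 instrument_law_intervene)
  then show ?thesis by (simp add: split_beta' density_1)
qed

text \<open>This is the importance-weighting formula: the derivative compares the law of
  \<open>(W, Z)\<close> prescribed by \<open>h\<close> with the one found in \<open>P\<close>. Only
  \<open>P\<close>, \<open>h\<close> and the fixed spaces enter.\<close>

definition intervened_law :: "'w measure \<Rightarrow> 'z measure \<Rightarrow> ('w \<times> 'z \<times> 'a \<times> real) measure \<Rightarrow>
    ('w \<Rightarrow> 'z \<Rightarrow> real) \<Rightarrow> ('w \<times> 'z \<times> 'a \<times> real) measure" where
  "intervened_law SW NZ P h = density P (\<lambda>(w, z, a, y).
     RN_deriv (distr P (SW \<Otimes>\<^sub>M NZ) (\<lambda>(w, z, a, y). (w, z)))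
       (density (distr P SW fst \<Otimes>\<^sub>M NZ) (\<lambda>(w, z). ennreal (h w z))) (w, z))"

lemma observed_law_intervene:
  assumes iv: "iv_intervention SW NZ NA S f h g" and pos: "instrument_positivity SW NZ S f"
  shows "observed_law SW NZ NA (intervene S f) = intervened_law SW NZ (observed_law SW NZ NA S) h"
proof -
  have scm: "iv_scm SW NZ NA S" and scm': "iv_scm SW NZ NA (intervene S f)"
    using iv by (auto simp: iv_intervention_def)
  interpret prob_space "Pr S" using scm by (simp add: iv_scm_def)
  note [measurable] = iv_scm_measurable[OF scm]
  let ?P = "observed_law SW NZ NA S"
  let ?L = "distr (Pr S) (SW \<Otimes>\<^sub>M NZ) (\<lambda>\<omega>. (var_W S \<omega>, var_Z S \<omega>))"
  let ?L' = "distr (Pr S) (SW \<Otimes>\<^sub>M NZ) (\<lambda>\<omega>. (var_W S \<omega>, var_Z (intervene S f) \<omega>))"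
  interpret L: prob_space ?L by (rule prob_space_distr) simp
  \<comment> \<open>Positivity supplies the absolute continuity that Radon-Nikodym needs.\<close>
  have "?L' = density ?L (RN_deriv ?L ?L')"
    using pos by (subst L.density_RN_deriv) (auto simp: instrument_positivity_def)
  moreover have "RN_deriv ?L ?L' \<in> borel_measurable (SW \<Otimes>\<^sub>M NZ)"
    using borel_measurable_RN_deriv[of ?L ?L'] by simp
  ultimately have "observed_law SW NZ NA (intervene S f) =
      density ?P (\<lambda>(w, z, a, y). RN_deriv ?L ?L' (w, z))"
    \<comment> \<open>The natural model is treated as the intervention with its own equation
      \<open>fZ S\<close>.\<close>
    using observed_law_change_density[of SW NZ NA S "fZ S" f "RN_deriv ?L ?L'"] iv
    by (simp add: intervene_fZ iv_intervention_def)
  \<comment> \<open>It remains to express both laws of covariates and instrument through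
    \<open>?P\<close> and \<open>h\<close>.\<close>
  moreover have "distr ?P (SW \<Otimes>\<^sub>M NZ) (\<lambda>(w, z, a, y). (w, z)) = ?L"
    unfolding observed_law_def split_beta' by (subst distr_distr) (simp_all add: comp_def)
  moreover have "distr ?P SW fst = distr (Pr S) SW (var_W S)"
    unfolding observed_law_def by (subst distr_distr) (simp_all add: comp_def)
  moreover have "?L' = density (distr (Pr S) SW (var_W S) \<Otimes>\<^sub>M NZ) (\<lambda>(w, z). ennreal (h w z))"
    using iv instrument_law_intervene[OF scm'] by (simp add: iv_intervention_def)
  ultimately show ?thesis by (simp add: intervened_law_def)
qed

section \<open>Mean outcome and treatment marginal as functionals of a law\<close>

definition law_mean :: "('w \<times> 'z \<times> 'a \<times> real) measure \<Rightarrow> real" where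
  "law_mean L = (LINT (w, z, a, y)|L. y)"

text \<open>A conditional density is determined only up to null sets. Choosing one from
  \<open>L\<close> alone makes the choice a function of the law, whichever model produced
  it.\<close>

definition law_treatment_density :: "'w measure \<Rightarrow> 'a measure \<Rightarrow>
    ('w \<times> 'z \<times> 'a \<times> real) measure \<Rightarrow> 'w \<Rightarrow> 'a \<Rightarrow> real" where
  "law_treatment_density SW NA L = (SOME q. cond_density L SW fst NA (\<lambda>(w, z, a, y). a) q)"

lemma iv_intervention_law:
  assumes "iv_intervention SW NZ NA S f h g" "observed_law SW NZ NA (intervene S f) = L"
  shows "(LINT \<omega>|Pr S. var_Y (intervene S f) \<omega>) = law_mean L"
    and "cond_density (Pr S) SW (var_W S) NA (var_A (intervene S f))
      (law_treatment_density SW NA L)"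
proof -
  have scm: "iv_scm SW NZ NA (intervene S f)" and NA: "sigma_finite_measure NA"
    and g: "cond_density (Pr S) SW (var_W S) NA (var_A (intervene S f)) g"
    using assms(1) by (auto simp: iv_intervention_def)
  show "(LINT \<omega>|Pr S. var_Y (intervene S f) \<omega>) = law_mean L"
    using integral_observed_law[OF scm] assms(2) by (simp add: law_mean_def)
  have iff: "cond_density L SW fst NA (\<lambda>(w, z, a, y). a) q \<longleftrightarrow>
      cond_density (Pr S) SW (var_W S) NA (var_A (intervene S f)) q" for q
    using cond_density_observed_law[OF scm NA] assms(2) by simp
  show "cond_density (Pr S) SW (var_W S) NA (var_A (intervene S f)) (law_treatment_density SW NA L)"
    unfolding law_treatment_density_def iff
    \<comment> \<open>The density \<open>g\<close> from \<open>iv_intervention\<close> witnesses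
      that the choice is not vacuous.\<close>
    by (rule someI[where P = "cond_density (Pr S) SW (var_W S) NA (var_A (intervene S f))", OF g])
qed

theorem theorem2:
  fixes S :: "('o, 'uw, 'uz, 'ua, 'uy, 'w, 'z, 'a) iv_scm"
    and SW :: "'w measure" and NZ :: "'z measure" and NA :: "'a measure"
    and fstar :: "'w \<Rightarrow> 'uz \<Rightarrow> 'z"
    and hstar :: "'w \<Rightarrow> 'z \<Rightarrow> real"
    and g :: "'w \<Rightarrow> 'a \<Rightarrow> real"
  assumes "iv_intervention SW NZ NA S fstar hstar g"
  shows
    \<comment> \<open>the structural equation of the counterfactual outcome\<close>
    "(\<forall>\<omega> \<in> space (Pr S). var_Y (intervene S fstar) \<omega> =
        fY S (var_A (intervene S fstar) \<omega>) (var_W S \<omega>) (UY S \<omega>)) \<and>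
    \<comment> \<open>dependence on the instrument only through the treatment\<close>
     (\<forall>f. \<forall>\<omega> \<in> space (Pr S). var_A (intervene S f) \<omega> = var_A (intervene S fstar) \<omega> \<longrightarrow>
        var_Y (intervene S f) \<omega> = var_Y (intervene S fstar) \<omega>) \<and>
    \<comment> \<open>within one structural model, mean and treatment marginal are functionals of the density\<close>
     (\<exists>\<Psi> \<Gamma>. \<forall>f h g'. iv_intervention SW NZ NA S f h g' \<longrightarrow>
        (LINT \<omega>|Pr S. var_Y (intervene S f) \<omega>) = \<Psi> h \<and>
        cond_density (Pr S) SW (var_W S) NA (var_A (intervene S f)) (\<Gamma> h)) \<and>
    \<comment> \<open>under positivity, they are functionals of the observed law and the density,
        uniformly over structural models\<close>
     (\<exists>(\<Psi> :: ('w \<times> 'z \<times> 'a \<times> real) measure \<Rightarrow> ('w \<Rightarrow> 'z \<Rightarrow> real) \<Rightarrow> real) \<Gamma>.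
        (instrument_positivity SW NZ S fstar \<longrightarrow>
           (LINT \<omega>|Pr S. var_Y (intervene S fstar) \<omega>) = \<Psi> (observed_law SW NZ NA S) hstar \<and>
           cond_density (Pr S) SW (var_W S) NA (var_A (intervene S fstar))
             (\<Gamma> (observed_law SW NZ NA S) hstar)) \<and>
        (\<forall>(S' :: ('o2, 'uw2, 'uz2, 'ua2, 'uy2, 'w, 'z, 'a) iv_scm) f h g'.
           iv_intervention SW NZ NA S' f h g' \<and> instrument_positivity SW NZ S' f \<longrightarrow>
           (LINT \<omega>|Pr S'. var_Y (intervene S' f) \<omega>) = \<Psi> (observed_law SW NZ NA S') h \<and>
           cond_density (Pr S') SW (var_W S') NA (var_A (intervene S' f))
             (\<Gamma> (observed_law SW NZ NA S') h))) \<and>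
    \<comment> \<open>the propagated world exists, and its mean outcome is that of the intervention\<close>
     (\<exists>A' Y'. propagated_world SW NA S fstar g A' Y') \<and>
     (\<forall>A' Y'. propagated_world SW NA S fstar g A' Y' \<longrightarrow>
        (LINT \<omega>|Pr S. var_Y (intervene S fstar) \<omega>) = (LINT \<omega>|Pr S. Y' \<omega>))"
proof (intro conjI)
  \<comment> \<open>\<open>intervene\<close> replaces only \<open>fZ\<close>, and \<open>fY\<close>
    has no instrument argument, so unfolding the outcome suffices.\<close>
  show "\<forall>\<omega> \<in> space (Pr S). var_Y (intervene S fstar) \<omega> =
      fY S (var_A (intervene S fstar) \<omega>) (var_W S \<omega>) (UY S \<omega>)"
    and "\<forall>f. \<forall>\<omega> \<in> space (Pr S). var_A (intervene S f) \<omega> = var_A (intervene S fstar) \<omega> \<longrightarrow>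
      var_Y (intervene S f) \<omega> = var_Y (intervene S fstar) \<omega>"
    by (simp_all add: var_Y_def)
next
  \<comment> \<open>\<open>\<Lambda> h\<close> is the law produced by some intervention with density
    \<open>h\<close>; \<open>observed_law_intervene_unique\<close> makes it the law of every such
    intervention. For an \<open>h\<close> that no intervention realises, the value is
    arbitrary.\<close>
  define \<Lambda> where "\<Lambda> h = (SOME L. \<exists>f g. iv_intervention SW NZ NA S f h g \<and>
      observed_law SW NZ NA (intervene S f) = L)" for h
  have "observed_law SW NZ NA (intervene S f) = \<Lambda> h"
    if "iv_intervention SW NZ NA S f h g'" for f h g'
  proof -
    have "\<exists>f g. iv_intervention SW NZ NA S f h g \<and> observed_law SW NZ NA (intervene S f) = \<Lambda> h"
      unfolding \<Lambda>_def by (rule someI) (use that in blast)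
    then show ?thesis using observed_law_intervene_unique[OF that] by metis
  qed
  note law = iv_intervention_law[OF _ this]
  show "\<exists>\<Psi> \<Gamma>. \<forall>f h g'. iv_intervention SW NZ NA S f h g' \<longrightarrow>
      (LINT \<omega>|Pr S. var_Y (intervene S f) \<omega>) = \<Psi> h \<and>
      cond_density (Pr S) SW (var_W S) NA (var_A (intervene S f)) (\<Gamma> h)"
    by (rule exI[of _ "\<lambda>h. law_mean (\<Lambda> h)"],
        rule exI[of _ "\<lambda>h. law_treatment_density SW NA (\<Lambda> h)"])
      (use law in blast)
next
  show "\<exists>(\<Psi> :: ('w \<times> 'z \<times> 'a \<times> real) measure \<Rightarrow> ('w \<Rightarrow> 'z \<Rightarrow> real) \<Rightarrow> real) \<Gamma>.
        (instrument_positivity SW NZ S fstar \<longrightarrow>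
           (LINT \<omega>|Pr S. var_Y (intervene S fstar) \<omega>) = \<Psi> (observed_law SW NZ NA S) hstar \<and>
           cond_density (Pr S) SW (var_W S) NA (var_A (intervene S fstar))
             (\<Gamma> (observed_law SW NZ NA S) hstar)) \<and>
        (\<forall>(S' :: ('o2, 'uw2, 'uz2, 'ua2, 'uy2, 'w, 'z, 'a) iv_scm) f h g'.
           iv_intervention SW NZ NA S' f h g' \<and> instrument_positivity SW NZ S' f \<longrightarrow>
           (LINT \<omega>|Pr S'. var_Y (intervene S' f) \<omega>) = \<Psi> (observed_law SW NZ NA S') h \<and>
           cond_density (Pr S') SW (var_W S') NA (var_A (intervene S' f))
             (\<Gamma> (observed_law SW NZ NA S') h))"
    \<comment> \<open>Both witnesses are computed from \<open>intervened_law\<close>, which mentions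
      no structural function or error, so they serve \<open>S\<close> and every \<open>S'\<close>
      alike.\<close>
    by (rule exI[of _ "\<lambda>P h. law_mean (intervened_law SW NZ P h)"],
        rule exI[of _ "\<lambda>P h. law_treatment_density SW NA (intervened_law SW NZ P h)"])
      (intro conjI allI impI;
        (elim conjE)?;
        rule iv_intervention_law[OF _ observed_law_intervene];
        (assumption | rule assms))
next
  \<comment> \<open>The intervened variables themselves realise the propagated world.\<close>
  have "propagated_world SW NA S fstar g (var_A (intervene S fstar)) (var_Y (intervene S fstar))"
    using assms by (auto simp: propagated_world_def iv_intervention_def var_A_def var_Y_def)
  then show "\<exists>A' Y'. propagated_world SW NA S fstar g A' Y'" by blast
  show "\<forall>A' Y'. propagated_world SW NA S fstar g A' Y' \<longrightarrow>
      (LINT \<omega>|Pr S. var_Y (intervene S fstar) \<omega>) = (LINT \<omega>|Pr S. Y' \<omega>)"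
  proof (intro allI impI)
    fix A' Y' assume "propagated_world SW NA S fstar g A' Y'"
    \<comment> \<open>The outcomes agree pointwise on the sample space, so their integrals agree,
      including when both take the default value.\<close>
    then have "var_Y (intervene S fstar) \<omega> = Y' \<omega>" if "\<omega> \<in> space (Pr S)" for \<omega>
      using that by (simp add: propagated_world_def var_A_def var_Y_def)
    then show "(LINT \<omega>|Pr S. var_Y (intervene S fstar) \<omega>) = (LINT \<omega>|Pr S. Y' \<omega>)"
      by (intro Bochner_Integration.integral_cong refl)
  qed
qed

end
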